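(* Let $n\ge 2$, $A=[a_{kj}]_{0\le k,j\le n-1}\in\mathbb{C}^{n\times n}$, and $c\in\mathbb{C}$. Suppose $A+cI_n$ is $\mathcal U$-apportionable. Then \[ |c|\le \frac{\sum_{k=0}^{n-1}|a_{kk}|}{n}+\sqrt{\left(\frac{\sum_{k=0}^{n-1}|a_{kk}|}{n}\right)^2+\frac{\|A\|_{\rm F}^2}{n(n-1)}}. \]
   Context: A complex square matrix $B=[b_{kj}]$ is uniform if there is a real number $c_0\ge 0$ with $|b_{kj}|=c_0$ for all $k,j$. A matrix $B\in\mathbb{C}^{n\times n}$ is $\mathcal U$-apportionable if there is an $n\times n$ unitary matrix $U$ such that $UBU^*$ is uniform. $\|A\|_{\rm F}=\sqrt{\sum_{k,j}|a_{kj}|^2}$ is the Frobenius norm. *)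

theory Defs
  imports "Jordan_Normal_Form.Schur_Decomposition" "Jordan_Normal_Form.Conjugate"
begin

definition uniform_mat :: "complex mat \<Rightarrow> bool" where
  "uniform_mat B \<longleftrightarrow>
     square_mat B \<and>
     (\<exists>c0::real. c0 \<ge> 0 \<and> (\<forall>k < dim_row B. \<forall>j < dim_col B. cmod (B $$ (k, j)) = c0))"

definition unitary_mat :: "nat \<Rightarrow> complex mat \<Rightarrow> bool" where
  "unitary_mat n U \<longleftrightarrow>
     U \<in> carrier_mat n n \<and>
     mat_adjoint U * U = 1\<^sub>m n \<and> U * mat_adjoint U = 1\<^sub>m n"

definition U_apportionable :: "nat \<Rightarrow> complex mat \<Rightarrow> bool" where
  "U_apportionable n B \<longleftrightarrow>
     B \<in> carrier_mat n n \<and>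
     (\<exists>U. unitary_mat n U \<and> uniform_mat (U * B * mat_adjoint U))"

definition frobenius_norm :: "complex mat \<Rightarrow> real" where
  "frobenius_norm A =
     sqrt (\<Sum>k < dim_row A. \<Sum>j < dim_col A. (cmod (A $$ (k, j)))\<^sup>2)"

end

theory Submission
  imports Defs
begin

text \<open>
  Unitary similarity preserves the trace and the Frobenius norm. For a uniform \<open>n \<times> n\<close> matrix \<open>M\<close>
  with entries of modulus \<open>c\<^sub>0\<close> one has \<open>|tr M| \<le> n c\<^sub>0 = \<parallel>M\<parallel>\<^sub>F\<close>, so \<open>B = A + c I\<close> satisfies
  \<open>|tr B|\<^sup>2 \<le> \<parallel>B\<parallel>\<^sub>F\<^sup>2\<close>. Expanding both sides in \<open>c\<close> gives
  \<open>n (n - 1) |c|\<^sup>2 \<le> \<parallel>A\<parallel>\<^sub>F\<^sup>2 + 2 (n - 1) |c| |tr A|\<close>, and completing the square yields the bound.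
\<close>

definition mat_trace :: "'a :: comm_monoid_add mat \<Rightarrow> 'a" where
  "mat_trace A = (\<Sum>i<dim_row A. A $$ (i, i))"

lemma mat_trace_mult_comm:
  fixes A B :: "'a :: comm_semiring_0 mat"
  assumes "A \<in> carrier_mat n m" "B \<in> carrier_mat m n"
  shows "mat_trace (A * B) = mat_trace (B * A)"
proof -
  have "mat_trace (A * B) = (\<Sum>i<n. \<Sum>j<m. A $$ (i, j) * B $$ (j, i))"
    using assms by (simp add: mat_trace_def scalar_prod_def atLeast0LessThan)
  also have "\<dots> = (\<Sum>j<m. \<Sum>i<n. B $$ (j, i) * A $$ (i, j))"
    by (subst sum.swap) (simp add: mult.commute)
  also have "\<dots> = mat_trace (B * A)"
    using assms by (simp add: mat_trace_def scalar_prod_def atLeast0LessThan)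
  finally show ?thesis .
qed

lemma dim_mat_adjoint [simp]:
  "dim_row (mat_adjoint A) = dim_col A" "dim_col (mat_adjoint A) = dim_row A"
  unfolding mat_adjoint_def by (simp_all add: mat_of_rows_def)

lemma mat_adjoint_carrier [simp]:
  "A \<in> carrier_mat n m \<Longrightarrow> mat_adjoint A \<in> carrier_mat m n"
  by auto

lemma mat_adjoint_index [simp]:
  assumes "i < dim_col A" "j < dim_row A"
  shows "mat_adjoint A $$ (i, j) = conjugate (A $$ (j, i))"
  using assms unfolding mat_adjoint_def by (simp add: mat_of_rows_index)

lemma mat_adjoint_adjoint [simp]: "mat_adjoint (mat_adjoint A) = A"
  by (rule eq_matI) simp_all

lemma mat_adjoint_mult:
  fixes A B :: "complex mat"
  assumes "A \<in> carrier_mat n m" "B \<in> carrier_mat m k"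
  shows "mat_adjoint (A * B) = mat_adjoint B * mat_adjoint A"
  using assms
  by (intro eq_matI) (auto simp: scalar_prod_def mult.commute intro!: sum.cong)

lemma frobenius_norm_sq:
  "(frobenius_norm A)\<^sup>2 = (\<Sum>k<dim_row A. \<Sum>j<dim_col A. (cmod (A $$ (k, j)))\<^sup>2)"
  unfolding frobenius_norm_def by (simp add: sum_nonneg)

text \<open>The diagonal entries of \<open>mat_adjoint A * A\<close> are the squared norms of the
  columns of \<open>A\<close>. In this form the norm inherits its unitary invariance from the
  trace.\<close>

lemma frobenius_norm_sq_trace:
  "complex_of_real ((frobenius_norm A)\<^sup>2) = mat_trace (mat_adjoint A * A)"
proof -
  have "mat_trace (mat_adjoint A * A) =
      (\<Sum>j<dim_col A. \<Sum>k<dim_row A. cnj (A $$ (k, j)) * A $$ (k, j))"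
    by (simp add: mat_trace_def scalar_prod_def atLeast0LessThan)
  also have "\<dots> = (\<Sum>k<dim_row A. \<Sum>j<dim_col A. cnj (A $$ (k, j)) * A $$ (k, j))"
    by (rule sum.swap)
  finally show ?thesis
    unfolding frobenius_norm_sq of_real_sum complex_norm_square by (simp only: mult.commute)
qed

lemma mat_trace_unitary_similarity:
  assumes U: "unitary_mat n U" and B: "B \<in> carrier_mat n n"
  shows "mat_trace (U * B * mat_adjoint U) = mat_trace B"
proof -
  have U': "U \<in> carrier_mat n n" and UU: "mat_adjoint U * U = 1\<^sub>m n"
    using U by (auto simp: unitary_mat_def)
  note V = mat_adjoint_carrier[OF U']
  \<comment> \<open>Cyclicity of the trace brings \<open>mat_adjoint U\<close> next to
    \<open>U\<close>, where the two cancel.\<close>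
  have "mat_trace (U * B * mat_adjoint U) = mat_trace (mat_adjoint U * (U * B))"
    by (rule mat_trace_mult_comm[OF mult_carrier_mat[OF U' B] V])
  also have "mat_adjoint U * (U * B) = B"
    using assoc_mult_mat[OF V U' B] UU B by simp
  finally show ?thesis .
qed

text \<open>Conjugation by \<open>U\<close> turns \<open>mat_adjoint B * B\<close> into a unitarily
  similar matrix, so the invariance of the trace applies to this product.\<close>

lemma frobenius_norm_unitary_similarity:
  assumes U: "unitary_mat n U" and B: "B \<in> carrier_mat n n"
  shows "(frobenius_norm (U * B * mat_adjoint U))\<^sup>2 = (frobenius_norm B)\<^sup>2"
proof -
  have U': "U \<in> carrier_mat n n" and UU: "mat_adjoint U * U = 1\<^sub>m n"
    using U by (auto simp: unitary_mat_def)
  note V = mat_adjoint_carrier[OF U'] and W = mat_adjoint_carrier[OF B]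
  let ?V = "mat_adjoint U" and ?W = "mat_adjoint B"
  have "mat_adjoint (U * B * ?V) * (U * B * ?V) = U * (?W * ?V) * (U * B * ?V)"
    using mat_adjoint_mult[OF mult_carrier_mat[OF U' B] V] mat_adjoint_mult[OF U' B] by simp
  also have "\<dots> = U * (?W * (?V * U) * (B * ?V))"
    using U' V W B by (simp add: assoc_mult_mat[of _ n n _ n _ n] mult_carrier_mat[of _ n n _ n])
  also have "\<dots> = U * (?W * B) * ?V"
    using U' V W B by (simp add: UU assoc_mult_mat[of _ n n _ n _ n] mult_carrier_mat[of _ n n _ n])
  finally have "mat_adjoint (U * B * ?V) * (U * B * ?V) = U * (?W * B) * ?V" .
  then have "complex_of_real ((frobenius_norm (U * B * ?V))\<^sup>2) = complex_of_real ((frobenius_norm B)\<^sup>2)"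
    unfolding frobenius_norm_sq_trace
    using mat_trace_unitary_similarity[OF U mult_carrier_mat[OF W B]] by simp
  then show ?thesis unfolding of_real_eq_iff .
qed

text \<open>Both sides are compared with the square of \<open>n * c0\<close>: the trace has
  \<open>n\<close> terms of modulus \<open>c0\<close>, while the norm collects \<open>n * n\<close>
  squares of \<open>c0\<close>.\<close>

lemma uniform_mat_trace_le_frobenius_norm:
  assumes "uniform_mat M"
  shows "(cmod (mat_trace M))\<^sup>2 \<le> (frobenius_norm M)\<^sup>2"
proof -
  obtain c0 where sq: "dim_row M = dim_col M" and c0: "c0 \<ge> 0"
    and M: "\<And>k j. k < dim_row M \<Longrightarrow> j < dim_col M \<Longrightarrow> cmod (M $$ (k, j)) = c0"
    using assms by (auto simp: uniform_mat_def)
  have "cmod (mat_trace M) \<le> (\<Sum>i<dim_row M. cmod (M $$ (i, i)))"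
    unfolding mat_trace_def by (rule norm_sum)
  also have "\<dots> = real (dim_row M) * c0"
    using M sq by simp
  finally have "(cmod (mat_trace M))\<^sup>2 \<le> (real (dim_row M) * c0)\<^sup>2"
    by (rule power_mono) simp
  also have "\<dots> = (frobenius_norm M)\<^sup>2"
    unfolding frobenius_norm_sq using M sq by (simp add: power2_eq_square)
  finally show ?thesis .
qed

lemma mat_trace_add_scalar:
  fixes A :: "'a :: comm_semiring_1 mat"
  assumes "A \<in> carrier_mat n n"
  shows "mat_trace (A + c \<cdot>\<^sub>m 1\<^sub>m n) = mat_trace A + of_nat n * c"
  using assms by (simp add: mat_trace_def sum.distrib)

text \<open>The cross term is real-linear in \<open>x\<close>, so for fixed \<open>y = c\<close> the
  diagonal cross terms add up to one involving the trace.\<close>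

lemma cmod_add_sq: "(cmod (x + y))\<^sup>2 = (cmod x)\<^sup>2 + 2 * Re (cnj y * x) + (cmod y)\<^sup>2"
  unfolding cmod_power2 by (simp add: power2_eq_square algebra_simps)

lemma frobenius_norm_sq_add_scalar:
  assumes A: "A \<in> carrier_mat n n"
  shows "(frobenius_norm (A + c \<cdot>\<^sub>m 1\<^sub>m n))\<^sup>2 =
    (frobenius_norm A)\<^sup>2 + 2 * Re (cnj c * mat_trace A) + real n * (cmod c)\<^sup>2"
proof -
  have "(\<Sum>j<n. (cmod ((A + c \<cdot>\<^sub>m 1\<^sub>m n) $$ (k, j)))\<^sup>2) =
      (\<Sum>j<n. (cmod (A $$ (k, j)))\<^sup>2) + (2 * Re (cnj c * A $$ (k, k)) + (cmod c)\<^sup>2)"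
    if k: "k < n" for k
  proof -
    \<comment> \<open>The shift alters only the diagonal entry of row \<open>k\<close>; writing the
      change as a conditional lets the sum over \<open>j\<close> collapse.\<close>
    have "(\<Sum>j<n. (cmod ((A + c \<cdot>\<^sub>m 1\<^sub>m n) $$ (k, j)))\<^sup>2) =
        (\<Sum>j<n. (cmod (A $$ (k, j)))\<^sup>2 +
          (if k = j then 2 * Re (cnj c * A $$ (k, k)) + (cmod c)\<^sup>2 else 0))"
      using A k by (intro sum.cong refl) (simp add: cmod_add_sq)
    then show ?thesis using k by (simp add: sum.distrib)
  qed
  then show ?thesis
    using A
    by (simp add: frobenius_norm_sq mat_trace_def sum.distrib
        flip: sum_distrib_left Re_sum sum_subtractf)
qed

theorem theorem3p1:
  fixes n :: nat and A :: "complex mat" and c :: complex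
  assumes "n \<ge> 2"
    and "A \<in> carrier_mat n n"
    and "U_apportionable n (A + c \<cdot>\<^sub>m 1\<^sub>m n)"
  shows "cmod c \<le> (\<Sum>k = 0..n - 1. cmod (A $$ (k, k))) / real n
           + sqrt (((\<Sum>k = 0..n - 1. cmod (A $$ (k, k))) / real n)\<^sup>2
                   + (frobenius_norm A)\<^sup>2 / (real n * (real n - 1)))"
proof -
  let ?B = "A + c \<cdot>\<^sub>m 1\<^sub>m n"
  define N where "N = real n"
  define S where "S = (\<Sum>k = 0..n - 1. cmod (A $$ (k, k)))"
  define F where "F = (frobenius_norm A)\<^sup>2"
  define t where "t = mat_trace A"
  have N: "N \<ge> 2" using assms(1) by (simp add: N_def)
  obtain U where U: "unitary_mat n U" and uni: "uniform_mat (U * ?B * mat_adjoint U)"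
    and B: "?B \<in> carrier_mat n n"
    using assms(3) by (auto simp: U_apportionable_def)
  \<comment> \<open>Subtraction on naturals truncates, so the two index sets would differ at
    \<open>n = 0\<close>.\<close>
  have "{0..n - 1} = {..<n}" using assms(1) by auto
  then have tS: "cmod t \<le> S"
    using assms(2) unfolding t_def S_def mat_trace_def by (simp add: norm_sum)
  have "(cmod (mat_trace ?B))\<^sup>2 \<le> (frobenius_norm ?B)\<^sup>2"
    using uniform_mat_trace_le_frobenius_norm[OF uni]
    by (simp only: mat_trace_unitary_similarity[OF U B] frobenius_norm_unitary_similarity[OF U B])
  then have "(cmod t)\<^sup>2 + 2 * N * Re (cnj c * t) + N\<^sup>2 * (cmod c)\<^sup>2
      \<le> F + 2 * Re (cnj c * t) + N * (cmod c)\<^sup>2"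
    unfolding mat_trace_add_scalar[OF assms(2)] frobenius_norm_sq_add_scalar[OF assms(2)]
      cmod_add_sq t_def F_def N_def
    by (simp add: norm_mult power_mult_distrib algebra_simps)
  \<comment> \<open>The nonnegative term \<open>(cmod t)\<^sup>2\<close> is discarded.\<close>
  then have "2 * N * Re (cnj c * t) + N\<^sup>2 * (cmod c)\<^sup>2
      \<le> F + 2 * Re (cnj c * t) + N * (cmod c)\<^sup>2"
    using zero_le_power2[of "cmod t"] by linarith
  then have "N * (N - 1) * (cmod c)\<^sup>2 \<le> F + 2 * (N - 1) * (- Re (cnj c * t))"
    by (simp add: algebra_simps power2_eq_square)
  \<comment> \<open>The sign of the cross term is unknown, so its worst case is taken.\<close>
  moreover have "- Re (cnj c * t) \<le> cmod c * S"
    using abs_Re_le_cmod[of "cnj c * t"] mult_left_mono[OF tS norm_ge_zero[of c]]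
    by (simp add: norm_mult)
  then have "2 * (N - 1) * (- Re (cnj c * t)) \<le> 2 * (N - 1) * (cmod c * S)"
    using N by (intro mult_left_mono) auto
  ultimately have quad: "N * (N - 1) * (cmod c)\<^sup>2 \<le> F + 2 * (N - 1) * (cmod c * S)"
    by linarith
  have "(cmod c)\<^sup>2 \<le> (F + 2 * (N - 1) * (cmod c * S)) / (N * (N - 1))"
    using quad N by (simp add: pos_le_divide_eq mult.commute)
  also have "\<dots> = F / (N * (N - 1)) + 2 * (cmod c * (S / N))"
    using N by (simp add: field_simps)
  \<comment> \<open>Completing the square in \<open>cmod c\<close>. The root can then be taken
    whatever the sign of \<open>cmod c - S / N\<close>.\<close>
  finally have "(cmod c - S / N)\<^sup>2 \<le> (S / N)\<^sup>2 + F / (N * (N - 1))"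
    by (simp add: power2_diff)
  then have "cmod c - S / N \<le> sqrt ((S / N)\<^sup>2 + F / (N * (N - 1)))"
    by (rule real_le_rsqrt)
  then show ?thesis by (simp add: N_def S_def F_def)
qed

end
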